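(* Let $N\in\mathbb{N}$ and let $F>0$ be an $\mathcal{F}_N$-measurable random variable. Then $$\mathrm{Ent}[F]\le E\left[\sum_{k=0}^ND_kF\,D_k\log F\right].$$
   Context: $\mathbb{N}=\{0,1,2,\ldots\}$. Let $(p_k)_{k\in\mathbb{N}}$ be a deterministic sequence in $(0,1)$ and $q_k=1-p_k$. Let $\Omega=\{-1,1\}^{\mathbb{N}}$ with its product $\sigma$-algebra, let $X_k:\Omega\to\{-1,1\}$ be the canonical projections, and let $\mathbb{P}$ be the product probability measure under which the $X_k$ are independent with $\mathbb{P}(X_k=1)=p_k$, $\mathbb{P}(X_k=-1)=q_k$. Set $\mathcal{F}_N=\sigma(X_0,\ldots,X_N)$. For $F:\Omega\to\mathbb{R}$, $D_kF(\omega)=\sqrt{p_kq_k}\,(F(\omega_+^k)-F(\omega_-^k))$, where $\omega_\pm^k$ is $\omega$ with its $k$-th coordinate replaced by $\pm1$. The entropy of $F>0$ is $\mathrm{Ent}[F]=E[F\log F]-E[F]\log E[F]$. *)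

theory Defs
  imports "HOL-Probability.Probability"
begin

definition Omega :: "(nat \<Rightarrow> int) set" where
  "Omega = (\<Pi>\<^sub>E k\<in>UNIV. {-1, 1})"

definition X :: "nat \<Rightarrow> (nat \<Rightarrow> int) \<Rightarrow> int" where
  "X k \<omega> = \<omega> k"

text \<open>The coordinate law is the measure on the discrete space \<open>{-1, 1}\<close> with weights
  \<open>p k\<close> and \<open>q k = 1 - p k\<close>, so that the product measure has underlying space
  \<^const>\<open>Omega\<close> and is a probability measure as soon as every \<open>p k\<close> lies in \<open>[0, 1]\<close>.\<close>

definition walk_measure :: "(nat \<Rightarrow> real) \<Rightarrow> (nat \<Rightarrow> int) measure" where
  "walk_measure p =
     (\<Pi>\<^sub>M k\<in>UNIV. point_measure {-1, 1} (\<lambda>x. ennreal (if x = 1 then p k else 1 - p k)))"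

lemma space_walk_measure: "space (walk_measure p) = Omega"
  by (simp add: walk_measure_def Omega_def space_PiM space_point_measure)

definition Fil :: "nat \<Rightarrow> (nat \<Rightarrow> int) measure" where
  "Fil N = sigma Omega {X k -` A \<inter> Omega | k A. k \<le> N}"

definition D :: "(nat \<Rightarrow> real) \<Rightarrow> nat \<Rightarrow> ((nat \<Rightarrow> int) \<Rightarrow> real) \<Rightarrow> (nat \<Rightarrow> int) \<Rightarrow> real" where
  "D p k F w = sqrt (p k * (1 - p k)) * (F (w(k := 1)) - F (w(k := -1)))"

definition Ent :: "'a measure \<Rightarrow> ('a \<Rightarrow> real) \<Rightarrow> real" where
  "Ent M F = (\<integral>\<omega>. F \<omega> * ln (F \<omega>) \<partial>M) - (\<integral>\<omega>. F \<omega> \<partial>M) * ln (\<integral>\<omega>. F \<omega> \<partial>M)"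

end

theory Submission
  imports Defs
begin

text \<open>The proof integrates out the coordinates one at a time, starting with the last one. Replacing
  \<open>F\<close> by its average \<open>G\<close> over coordinate \<open>n\<close> costs at most the \<open>n\<close>-th summand in entropy,
  by the concavity of \<open>ln\<close>. The other summands do not increase, because the function
  \<open>(a - b) (ln a - ln b)\<close> is jointly convex, by the log-sum inequality.\<close>

section \<open>Functions of finitely many coordinates\<close>

text \<open>The bound \<open>k < n\<close> is strict, so that \<open>n = 0\<close> means constant on
  \<open>Omega\<close> and an induction on \<open>n\<close> can start there. Points outside
  \<open>Omega\<close> are ignored, as they lie outside the probability space.\<close>

definition cylinder :: "nat \<Rightarrow> ((nat \<Rightarrow> int) \<Rightarrow> 'a) \<Rightarrow> bool" where
  "cylinder n f \<longleftrightarrow> (\<forall>v\<in>Omega. \<forall>w\<in>Omega. (\<forall>k<n. v k = w k) \<longrightarrow> f v = f w)"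

text \<open>Conditional expectation given all coordinates other than \<open>k\<close>, written out
  pointwise as a two-term sum so that no almost-sure identities arise.\<close>

definition avg :: "(nat \<Rightarrow> real) \<Rightarrow> nat \<Rightarrow> ((nat \<Rightarrow> int) \<Rightarrow> real) \<Rightarrow> (nat \<Rightarrow> int) \<Rightarrow> real" where
  "avg p k f w = p k * f (w(k := 1)) + (1 - p k) * f (w(k := -1))"

lemma Omega_iff: "w \<in> Omega \<longleftrightarrow> (\<forall>k. w k = 1 \<or> w k = -1)"
  by (auto simp: Omega_def PiE_def Pi_def)

lemma Omega_upd: "w \<in> Omega \<Longrightarrow> x = 1 \<or> x = -1 \<Longrightarrow> w(k := x) \<in> Omega"
  by (auto simp: Omega_iff)

lemma cylinderD:
  "cylinder n f \<Longrightarrow> v \<in> Omega \<Longrightarrow> w \<in> Omega \<Longrightarrow> (\<And>k. k < n \<Longrightarrow> v k = w k) \<Longrightarrow> f v = f w"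
  unfolding cylinder_def by blast

lemma cylinder_comp2:
  assumes "cylinder n f" "cylinder n g"
  shows "cylinder n (\<lambda>w. h (f w) (g w))"
  unfolding cylinder_def
  by (intro ballI impI arg_cong2[where f = h] cylinderD[OF assms(1)] cylinderD[OF assms(2)]) auto

lemma cylinder_comp: "cylinder n f \<Longrightarrow> cylinder n (\<lambda>w. h (f w))"
  by (rule cylinder_comp2[where h = "\<lambda>x _. h x"])

lemma cylinder_sum:
  "(\<And>i. i \<in> I \<Longrightarrow> cylinder n (f i)) \<Longrightarrow> cylinder n (\<lambda>w. \<Sum>i\<in>I. f i w)"
  unfolding cylinder_def by (intro ballI impI sum.cong refl) blast

lemma cylinder_upd:
  assumes "cylinder n f" "x = 1 \<or> x = -1"
  shows "cylinder n (\<lambda>w. f (w(k := x)))"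
  unfolding cylinder_def
  by (intro ballI impI cylinderD[OF assms(1)] Omega_upd assms(2)) auto

text \<open>Fixing coordinate \<open>n\<close> removes the last dependence of \<open>f\<close>; this
  is what lowers the index in the inductions below.\<close>

lemma cylinder_upd_last:
  assumes "cylinder (Suc n) f" "x = 1 \<or> x = -1"
  shows "cylinder n (\<lambda>w. f (w(n := x)))"
  unfolding cylinder_def
  by (intro ballI impI cylinderD[OF assms(1)] Omega_upd assms(2)) (auto simp: less_Suc_eq)

lemma cylinder_avg_last: "cylinder (Suc n) f \<Longrightarrow> cylinder n (avg p n f)"
  unfolding avg_def
  by (intro cylinder_comp2[where h = "\<lambda>x y. p n * x + (1 - p n) * y"] cylinder_upd_last) auto

lemma cylinder_D: "cylinder n f \<Longrightarrow> cylinder n (D p k f)"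
  unfolding D_def
  by (intro cylinder_comp2[where h = "\<lambda>x y. sqrt (p k * (1 - p k)) * (x - y)"] cylinder_upd) auto

lemma cylinder_D_mult_D_ln:
  "cylinder n f \<Longrightarrow> cylinder n (\<lambda>w. D p k f w * D p k (\<lambda>w. ln (f w)) w)"
  by (intro cylinder_comp2[where h = "(*)"] cylinder_D cylinder_comp[where h = ln])

text \<open>A generated sigma-algebra cannot separate two points that no generator separates. The
  index is \<open>Suc n\<close> because \<open>Fil n\<close> includes coordinate \<open>n\<close>
  itself.\<close>

lemma cylinder_Fil_measurable:
  fixes f :: "(nat \<Rightarrow> int) \<Rightarrow> real"
  assumes "f \<in> borel_measurable (Fil n)"
  shows "cylinder (Suc n) f"
proof -
  have gen: "{X k -` A \<inter> Omega |k A. k \<le> n} \<subseteq> Pow Omega" by auto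
  have saturated: "v \<in> S \<longleftrightarrow> w \<in> S"
    if "S \<in> sigma_sets Omega {X k -` A \<inter> Omega |k A. k \<le> n}"
      and vw: "v \<in> Omega" "w \<in> Omega" "\<forall>k<Suc n. v k = w k" for S v w
    using that(1)
  proof induction
    case (Basic S)
    then show ?case using vw by (auto simp: X_def less_Suc_eq_le)
  qed (use vw in auto)
  show ?thesis unfolding cylinder_def
  proof (intro ballI impI)
    fix v w assume vw: "v \<in> Omega" "w \<in> Omega" "\<forall>k<Suc n. v k = w k"
    \<comment> \<open>The level set of \<open>f\<close> through \<open>v\<close> is measurable, so
      it contains with \<open>v\<close> every \<open>w\<close> that agrees with \<open>v\<close> up
      to coordinate \<open>n\<close>.\<close>
    have "f -` {f v} \<inter> space (Fil n) \<in> sets (Fil n)"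
      using assms by (rule measurable_sets) auto
    then have "f -` {f v} \<inter> Omega \<in> sigma_sets Omega {X k -` A \<inter> Omega |k A. k \<le> n}"
      using gen by (simp add: Fil_def sets_measure_of space_measure_of)
    from saturated[OF this vw] show "f v = f w" using vw by auto
  qed
qed

section \<open>Convexity inequalities for real numbers\<close>

text \<open>The function \<open>a * (ln a - ln b)\<close> is convex and homogeneous of degree one in
  \<open>(a, b)\<close>; the left-hand side is its tangent plane at \<open>(A, B)\<close>. The bound
  reduces to ln x \<le> x - 1 at x = bA/(aB).\<close>

lemma kl_tangent:
  fixes a b A B :: real
  assumes "a > 0" "b > 0" "A > 0" "B > 0"
  shows "a * (ln A - ln B) + a - b * A / B \<le> a * (ln a - ln b)"
proof -
  have "ln (b * A) - ln (a * B) \<le> (b * A - a * B) / (a * B)"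
    using assms by (intro ln_diff_le) auto
  then have "ln b + ln A - ln a - ln B \<le> b * A / (a * B) - 1"
    using assms by (simp add: ln_mult diff_divide_distrib)
  then have "a * (ln b + ln A - ln a - ln B) \<le> a * (b * A / (a * B) - 1)"
    using assms by (intro mult_left_mono) auto
  also have "\<dots> = b * A / B - a" using assms by (simp add: field_simps)
  finally show ?thesis by (simp add: algebra_simps)
qed

lemma log_sum_inequality:
  fixes s t a b c d :: real
  assumes "s > 0" "t > 0" "a > 0" "b > 0" "c > 0" "d > 0"
  shows "(s * a + t * c) * (ln (s * a + t * c) - ln (s * b + t * d))
    \<le> s * (a * (ln a - ln b)) + t * (c * (ln c - ln d))"
proof -
  define A where "A = s * a + t * c"
  define B where "B = s * b + t * d"
  have pos: "A > 0" "B > 0" using assms by (auto simp: A_def B_def intro!: add_pos_pos)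
  \<comment> \<open>Taking the tangent at the weighted sums makes the affine corrections cancel:
    they add up to A - B * (A / B) = 0.\<close>
  have "s * (a * L + a - b * A / B) + t * (c * L + c - d * A / B)
      = (s * a + t * c) * L + (s * a + t * c) - (s * b + t * d) * A / B" for L
    by (simp add: algebra_simps add_divide_distrib)
  then have "A * (ln A - ln B)
      = s * (a * (ln A - ln B) + a - b * A / B) + t * (c * (ln A - ln B) + c - d * A / B)"
    using pos by (simp flip: A_def B_def)
  also have "\<dots> \<le> s * (a * (ln a - ln b)) + t * (c * (ln c - ln d))"
    using assms pos by (intro add_mono mult_left_mono kl_tangent) auto
  finally show ?thesis by (simp add: A_def B_def)
qed

text \<open>The product (a - b)(ln a - ln b) splits as a(ln a - ln b) + b(ln b - ln a), so the
  log-sum inequality is used twice, the second time with numerators and denominators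
  exchanged.\<close>

lemma diff_mult_diff_ln_convex:
  fixes s t a b c d :: real
  assumes "s > 0" "t > 0" "a > 0" "b > 0" "c > 0" "d > 0"
  shows "((s * a + t * c) - (s * b + t * d)) * (ln (s * a + t * c) - ln (s * b + t * d))
    \<le> s * ((a - b) * (ln a - ln b)) + t * ((c - d) * (ln c - ln d))"
  using log_sum_inequality[OF assms] log_sum_inequality[of s t b a d c] assms
  by (simp add: algebra_simps)

text \<open>For a variable Y with values \<open>a\<close>, \<open>b\<close> of probabilities
  \<open>s\<close>, \<open>1 - s\<close>, E[Y ln Y] = E[Y] E[ln Y] + Cov(Y, ln Y). The covariance is
  exactly the last term, and Jensen's inequality bounds E[ln Y] by ln E[Y].\<close>

lemma two_point_entropy:
  fixes s a b :: real
  assumes "0 < s" "s < 1" "a > 0" "b > 0"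
  shows "s * (a * ln a) + (1 - s) * (b * ln b)
    \<le> (s * a + (1 - s) * b) * ln (s * a + (1 - s) * b) + s * (1 - s) * ((a - b) * (ln a - ln b))"
proof -
  define m where "m = s * a + (1 - s) * b"
  have m: "m > 0" using assms by (auto simp: m_def intro!: add_pos_pos)
  \<comment> \<open>Jensen's inequality for \<open>ln\<close>, via its tangent at the mean
    \<open>m\<close>.\<close>
  have "s * (ln a - ln m) + (1 - s) * (ln b - ln m) \<le> s * ((a - m) / m) + (1 - s) * ((b - m) / m)"
    using assms m by (intro add_mono mult_left_mono ln_diff_le) auto
  also have "\<dots> = (s * a + (1 - s) * b - m) / m"
    by (simp add: add_divide_distrib diff_divide_distrib algebra_simps)
  also have "\<dots> = 0" by (simp add: m_def)
  finally have "s * ln a + (1 - s) * ln b \<le> ln m" by (simp add: algebra_simps)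
  then have "m * (s * ln a + (1 - s) * ln b) \<le> m * ln m" using m by simp
  moreover have "s * (a * ln a) + (1 - s) * (b * ln b)
      = m * (s * ln a + (1 - s) * ln b) + s * (1 - s) * ((a - b) * (ln a - ln b))"
    by (simp add: m_def algebra_simps)
  ultimately show ?thesis by (simp add: m_def)
qed

section \<open>Discrete gradients under averaging\<close>

lemma D_mult_D:
  assumes "0 < p k" "p k < 1"
  shows "D p k f w * D p k g w
    = p k * (1 - p k) * ((f (w(k := 1)) - f (w(k := -1))) * (g (w(k := 1)) - g (w(k := -1))))"
proof -
  have "sqrt (p k * (1 - p k)) * sqrt (p k * (1 - p k)) = p k * (1 - p k)"
    using assms by simp
  then show ?thesis unfolding D_def by (simp add: mult.assoc mult.left_commute)
qed

text \<open>Updates at the distinct coordinates \<open>k\<close> and \<open>n\<close> commute, so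
  only four values of \<open>f\<close> occur. The averages over \<open>n\<close> are mixtures with
  weights \<open>p n\<close> and \<open>1 - p n\<close>, to which joint convexity applies.\<close>

lemma D_avg_mult_D_ln_le:
  assumes p: "\<And>k. 0 < p k \<and> p k < 1" and pos: "\<And>\<omega>. \<omega> \<in> Omega \<Longrightarrow> f \<omega> > 0"
    and w: "w \<in> Omega" and "k \<noteq> n"
  shows "D p k (avg p n f) w * D p k (\<lambda>w. ln (avg p n f w)) w
    \<le> avg p n (\<lambda>w. D p k f w * D p k (\<lambda>w. ln (f w)) w) w"
proof -
  let ?f = "\<lambda>x y. f (w(k := x, n := y))"
  have upd: "w(n := y, k := x) = w(k := x, n := y)" for x y :: int
    using \<open>k \<noteq> n\<close> by (simp add: fun_upd_twist)
  have pos': "?f x y > 0" if "x = 1 \<or> x = -1" "y = 1 \<or> y = -1" for x y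
    using that w by (intro pos Omega_upd)
  have "((p n * ?f 1 1 + (1 - p n) * ?f 1 (-1)) - (p n * ?f (-1) 1 + (1 - p n) * ?f (-1) (-1)))
      * (ln (p n * ?f 1 1 + (1 - p n) * ?f 1 (-1)) - ln (p n * ?f (-1) 1 + (1 - p n) * ?f (-1) (-1)))
    \<le> p n * ((?f 1 1 - ?f (-1) 1) * (ln (?f 1 1) - ln (?f (-1) 1)))
      + (1 - p n) * ((?f 1 (-1) - ?f (-1) (-1)) * (ln (?f 1 (-1)) - ln (?f (-1) (-1))))"
    using p[of n] by (intro diff_mult_diff_ln_convex pos') auto
  from mult_left_mono[OF this, of "p k * (1 - p k)"] show ?thesis
    using p[of k] by (simp add: D_mult_D avg_def upd distrib_left mult.left_commute)
qed

lemma avg_sum: "avg p n (\<lambda>w. \<Sum>i\<in>I. f i w) w = (\<Sum>i\<in>I. avg p n (f i) w)"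
  by (simp add: avg_def sum.distrib sum_distrib_left)

section \<open>Integration against the product measure\<close>

context
  fixes p :: "nat \<Rightarrow> real"
  assumes p: "\<And>k. 0 < p k \<and> p k < 1"
begin

abbreviation coord_law :: "nat \<Rightarrow> int measure" where
  "coord_law k \<equiv> point_measure {-1, 1} (\<lambda>x. ennreal (if x = 1 then p k else 1 - p k))"

lemma prob_space_coord_law: "prob_space (coord_law k)"
  using p[of k] by (intro prob_space_point_measure) (auto simp flip: ennreal_plus)

interpretation W: prob_space "walk_measure p"
  unfolding walk_measure_def by (intro prob_space_PiM prob_space_coord_law)

lemma measurable_coord_eq: "Measurable.pred (walk_measure p) (\<lambda>w. w n = 1)"
proof -
  have "(\<lambda>w. w n) \<in> measurable (walk_measure p) (coord_law n)"
    unfolding walk_measure_def by (rule measurable_component_singleton) simp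
  moreover have "Measurable.pred (coord_law n) (\<lambda>x. x = 1)"
    by (auto simp: pred_def sets_point_measure space_point_measure)
  ultimately show ?thesis by (rule measurable_compose)
qed

text \<open>Finiteness of the range is carried along because it gives boundedness, hence
  integrability.\<close>

lemma cylinder_measurable_finite:
  fixes f :: "(nat \<Rightarrow> int) \<Rightarrow> real"
  assumes "cylinder n f"
  shows "f \<in> borel_measurable (walk_measure p) \<and> finite (f ` Omega)"
  using assms
proof (induction n arbitrary: f)
  case 0
  have one: "(\<lambda>_. 1) \<in> Omega" by (simp add: Omega_iff)
  have const: "f w = f (\<lambda>_. 1)" if "w \<in> Omega" for w
    using cylinderD[OF 0 that one] by simp
  then have "f \<in> borel_measurable (walk_measure p)"
    by (subst measurable_cong[where g = "\<lambda>_. f (\<lambda>_. 1)"]) (auto simp: space_walk_measure)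
  moreover have "f ` Omega \<subseteq> {f (\<lambda>_. 1)}" using const by auto
  ultimately show ?case by (auto intro: finite_subset)
next
  case (Suc n)
  let ?u = "\<lambda>x w. f (w(n := x))"
  have IH: "?u x \<in> borel_measurable (walk_measure p)" "finite (?u x ` Omega)"
    if "x = 1 \<or> x = -1" for x
    using Suc.IH[OF cylinder_upd_last[OF Suc.prems that]] by blast+
  \<comment> \<open>On \<open>Omega\<close> the coordinate \<open>w n\<close> is 1 or -1, so one of
    the two updates leaves \<open>w\<close> unchanged.\<close>
  have split: "f w = (if w n = 1 then ?u 1 w else ?u (-1) w)" if "w \<in> Omega" for w
  proof -
    have "w n = 1 \<or> w n = -1" using that by (simp add: Omega_iff)
    then show ?thesis by (metis fun_upd_triv one_neq_neg_one)
  qed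
  have "(\<lambda>w. if w n = 1 then ?u 1 w else ?u (-1) w) \<in> borel_measurable (walk_measure p)"
    by (intro measurable_If IH measurable_coord_eq[unfolded pred_def]) auto
  then have "f \<in> borel_measurable (walk_measure p)"
    by (subst measurable_cong) (auto simp: space_walk_measure split)
  moreover have "f ` Omega \<subseteq> ?u 1 ` Omega \<union> ?u (-1) ` Omega"
    using split by (auto simp: image_iff)
  then have "finite (f ` Omega)" by (rule finite_subset) (use IH in auto)
  ultimately show ?case ..
qed

lemma cylinder_integrable:
  fixes f :: "(nat \<Rightarrow> int) \<Rightarrow> real"
  assumes "cylinder n f"
  shows "integrable (walk_measure p) f"
proof -
  have "bounded (f ` Omega)"
    using cylinder_measurable_finite[OF assms] by (blast intro: finite_imp_bounded)
  then obtain B where "\<And>w. w \<in> Omega \<Longrightarrow> norm (f w) \<le> B" by (auto simp: bounded_iff)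
  then show ?thesis
    using cylinder_measurable_finite[OF assms]
    by (intro W.integrable_const_bound[where B = B]) (auto simp: space_walk_measure)
qed

text \<open>Resampling coordinate \<open>k\<close> independently from its own law preserves the
  product measure; Fubini then turns the integral over the new coordinate into
  \<open>avg\<close>.\<close>

lemma integral_avg:
  assumes "cylinder n f"
  shows "(\<integral>w. avg p k f w \<partial>walk_measure p) = (\<integral>w. f w \<partial>walk_measure p)"
proof -
  interpret L: prob_space "coord_law k" by (rule prob_space_coord_law)
  interpret LW: pair_prob_space "coord_law k" "walk_measure p" ..
  let ?h = "\<lambda>(x, w). w(k := x)"
  have eq: "distr (coord_law k \<Otimes>\<^sub>M walk_measure p) (walk_measure p) ?h = walk_measure p"
    using distr_pair_PiM_eq_PiM[of UNIV coord_law k, OF prob_space_coord_law prob_space_coord_law]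
    by (simp add: walk_measure_def)
  have h: "?h \<in> measurable (coord_law k \<Otimes>\<^sub>M walk_measure p) (walk_measure p)"
    unfolding walk_measure_def case_prod_beta
    by (rule measurable_fun_upd[where J = UNIV]) auto
  have int: "integrable (walk_measure p) f"
    using assms by (rule cylinder_integrable)
  have int_upd: "integrable (walk_measure p) (\<lambda>w. f (w(k := x)))" if "x = 1 \<or> x = -1" for x
    using cylinder_upd[OF assms that] by (rule cylinder_integrable)
  have int': "integrable (coord_law k \<Otimes>\<^sub>M walk_measure p) (\<lambda>z. f (?h z))"
    using int by (subst (asm) eq[symmetric]) (rule integrable_distr[OF h])
  have "(\<integral>w. f w \<partial>walk_measure p) = (\<integral>z. f (?h z) \<partial>(coord_law k \<Otimes>\<^sub>M walk_measure p))"
    using h int by (subst eq[symmetric], subst integral_distr) auto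
  also have "\<dots> = (\<integral>x. \<integral>w. f (w(k := x)) \<partial>walk_measure p \<partial>coord_law k)"
    using LW.integral_fst'[OF int'] by (simp add: case_prod_beta)
  also have "\<dots> = p k * (\<integral>w. f (w(k := 1)) \<partial>walk_measure p)
      + (1 - p k) * (\<integral>w. f (w(k := -1)) \<partial>walk_measure p)"
    using p[of k]
    by (subst lebesgue_integral_point_measure_finite) auto
  also have "\<dots> = (\<integral>w. avg p k f w \<partial>walk_measure p)"
    unfolding avg_def using int_upd by simp
  finally show ?thesis ..
qed

text \<open>The induction keeps \<open>f\<close> arbitrary, since its hypothesis is applied to
  \<open>avg p n f\<close>.\<close>

lemma entropy_le_cylinder:
  assumes "cylinder n f" and "\<And>\<omega>. \<omega> \<in> Omega \<Longrightarrow> f \<omega> > 0"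
  shows "Ent (walk_measure p) f
    \<le> (\<integral>\<omega>. (\<Sum>k<n. D p k f \<omega> * D p k (\<lambda>\<omega>'. ln (f \<omega>')) \<omega>) \<partial>walk_measure p)"
  using assms
proof (induction n arbitrary: f)
  case 0
  have one: "(\<lambda>_. 1) \<in> Omega" by (simp add: Omega_iff)
  have const: "f w = f (\<lambda>_. 1)" if "w \<in> Omega" for w
    using cylinderD[OF 0(1) that one] by simp
  \<comment> \<open>A constant has zero entropy under a probability measure, and the sum of
    gradients is empty.\<close>
  have "(\<integral>w. f w \<partial>walk_measure p) = (\<integral>w. f (\<lambda>_. 1) \<partial>walk_measure p)"
    "(\<integral>w. f w * ln (f w) \<partial>walk_measure p) = (\<integral>w. f (\<lambda>_. 1) * ln (f (\<lambda>_. 1)) \<partial>walk_measure p)"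
    by (rule Bochner_Integration.integral_cong[OF refl],
        metis const space_walk_measure)+
  then show ?case
    by (simp add: Ent_def W.prob_space[unfolded space_walk_measure] space_walk_measure)
next
  case (Suc n)
  let ?E = "\<lambda>f. \<integral>w. f w \<partial>walk_measure p"
  let ?S = "\<lambda>k f w. D p k f w * D p k (\<lambda>w. ln (f w)) w"
  define g where "g = avg p n f"
  note cf = Suc.prems(1) and pos = Suc.prems(2)
  have cg: "cylinder n g" unfolding g_def by (rule cylinder_avg_last[OF cf])
  have gpos: "g w > 0" if "w \<in> Omega" for w
    unfolding g_def avg_def using p[of n] that
    by (intro add_pos_pos mult_pos_pos pos Omega_upd) auto
  have cflnf: "cylinder (Suc n) (\<lambda>w. f w * ln (f w))"
    by (rule cylinder_comp[OF cf])
  have cS: "cylinder (Suc n) (\<lambda>w. \<Sum>k<m. ?S k f w)" for m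
    by (intro cylinder_sum cylinder_D_mult_D_ln cf)
  have int_glng: "integrable (walk_measure p) (\<lambda>w. g w * ln (g w))"
    by (rule cylinder_integrable[OF cylinder_comp[OF cg]])
  have int_S: "integrable (walk_measure p) (?S k f)" for k
    by (rule cylinder_integrable[OF cylinder_D_mult_D_ln[OF cf]])
  have "?E (\<lambda>w. f w * ln (f w)) = ?E (avg p n (\<lambda>w. f w * ln (f w)))"
    using integral_avg[OF cflnf] by simp
  \<comment> \<open>The two-point bound holds pointwise with \<open>s = p n\<close>. The term
    \<open>?S n f\<close> appears without averaging because it does not depend on coordinate
    \<open>n\<close>.\<close>
  also have "\<dots> \<le> ?E (\<lambda>w. g w * ln (g w) + ?S n f w)"
  proof (rule integral_mono)
    show "integrable (walk_measure p) (avg p n (\<lambda>w. f w * ln (f w)))"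
      by (rule cylinder_integrable[OF cylinder_avg_last[OF cflnf]])
    show "integrable (walk_measure p) (\<lambda>w. g w * ln (g w) + ?S n f w)"
      using int_glng int_S by simp
    fix w assume "w \<in> space (walk_measure p)"
    then have w: "w \<in> Omega" by (simp add: space_walk_measure)
    show "avg p n (\<lambda>w. f w * ln (f w)) w \<le> g w * ln (g w) + ?S n f w"
      using two_point_entropy[of "p n" "f (w(n := 1))" "f (w(n := -1))"] p[of n]
        pos[OF Omega_upd[OF w]]
      by (simp add: D_mult_D g_def avg_def)
  qed
  also have "\<dots> = ?E (\<lambda>w. g w * ln (g w)) + ?E (?S n f)"
    using int_glng int_S by simp
  finally have *: "?E (\<lambda>w. f w * ln (f w)) \<le> ?E (\<lambda>w. g w * ln (g w)) + ?E (?S n f)" .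
  have "Ent (walk_measure p) g \<le> ?E (\<lambda>w. \<Sum>k<n. ?S k g w)"
    by (rule Suc.IH[OF cg gpos])
  \<comment> \<open>Here \<open>k < n\<close>, so each summand involves a coordinate different from
    the averaged one.\<close>
  also have "\<dots> \<le> ?E (avg p n (\<lambda>w. \<Sum>k<n. ?S k f w))"
  proof (rule integral_mono)
    show "integrable (walk_measure p) (\<lambda>w. \<Sum>k<n. ?S k g w)"
      by (rule cylinder_integrable[where n = n], intro cylinder_sum cylinder_D_mult_D_ln cg)
    show "integrable (walk_measure p) (avg p n (\<lambda>w. \<Sum>k<n. ?S k f w))"
      by (rule cylinder_integrable[OF cylinder_avg_last[OF cS]])
    fix w assume "w \<in> space (walk_measure p)"
    then have w: "w \<in> Omega" by (simp add: space_walk_measure)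
    show "(\<Sum>k<n. ?S k g w) \<le> avg p n (\<lambda>w. \<Sum>k<n. ?S k f w) w"
      unfolding avg_sum g_def by (intro sum_mono D_avg_mult_D_ln_le p pos w) auto
  qed
  also have "\<dots> = ?E (\<lambda>w. \<Sum>k<n. ?S k f w)" by (rule integral_avg[OF cS])
  finally have "Ent (walk_measure p) g \<le> ?E (\<lambda>w. \<Sum>k<n. ?S k f w)" .
  moreover have "?E g = ?E f" unfolding g_def by (rule integral_avg[OF cf])
  moreover have "?E (\<lambda>w. \<Sum>k<Suc n. ?S k f w) = ?E (\<lambda>w. \<Sum>k<n. ?S k f w) + ?E (?S n f)"
    using int_S by simp
  ultimately show ?case using * unfolding Ent_def by simp
qed

end

theorem theorem13p5:
  fixes p :: "nat \<Rightarrow> real" and N :: nat and F :: "(nat \<Rightarrow> int) \<Rightarrow> real"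
  assumes p: "\<And>k. 0 < p k \<and> p k < 1"
    and F_measurable: "F \<in> borel_measurable (Fil N)"
    and F_pos: "\<And>\<omega>. \<omega> \<in> Omega \<Longrightarrow> F \<omega> > 0"
  shows "Ent (walk_measure p) F
    \<le> (\<integral>\<omega>. (\<Sum>k=0..N. D p k F \<omega> * D p k (\<lambda>\<omega>'. ln (F \<omega>')) \<omega>) \<partial>walk_measure p)"
  \<comment> \<open>The coordinates 0 to \<open>N\<close> are those below
    \<open>Suc N\<close>.\<close>
  using entropy_le_cylinder[OF p cylinder_Fil_measurable[OF F_measurable] F_pos]
  by (simp add: atLeast0AtMost lessThan_Suc_atMost)

end
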